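(* Fix a node speed $v>0$ and let the direction change rate be $\tau=0$ (pure billiard model). As the node density $\nu=\frac{n}{\mathcal{A}}\to 0$, the propagation speed upper bound $s(\nu)$ satisfies $$ s(\nu)=(1+O(\nu^2))\,v . $$
   Context: The network consists of $n$ mobile nodes in a square of area $\mathcal{A}=L\times L$ with $L\to\infty$, node density $\nu=n/\mathcal{A}$, node speed $v$, and node direction change rate $\tau=0$ (nodes change direction only when they hit the border). For $0<\nu<1/\pi$, the propagation speed upper bound in this case is the number $$ s(\nu)=\min\left\{\frac{\theta}{\rho}\;:\;\rho>0,\ \theta>0,\ 1-\nu\pi\tfrac{2}{\rho}I_1(\rho)>0,\ \theta=\sqrt{\rho^2v^2+\left(\frac{4\pi v\,\nu\, I_0(\rho)}{1-\nu\pi\frac{2}{\rho}I_1(\rho)}\right)^2}\right\}, $$ where $I_0(x)=\sum_{k\ge 0}\left(\frac{x}{2}\right)^{2k}\frac{1}{(k!)^2}$ and $I_1(x)=\sum_{k\ge 0}\left(\frac{x}{2}\right)^{2k+1}\frac{1}{(k+1)!\,k!}$ are modified Bessel functions. *)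

theory Defs
  imports Complex_Main "HOL-Library.Landau_Symbols"
begin

text \<open>Modified Bessel functions of the first kind, of orders 0 and 1, on the reals.\<close>

definition bessel_I0 :: "real \<Rightarrow> real" where
  "bessel_I0 x = (\<Sum>k. (x / 2) ^ (2 * k) * (1 / (fact k)\<^sup>2))"

definition bessel_I1 :: "real \<Rightarrow> real" where
  "bessel_I1 x = (\<Sum>k. (x / 2) ^ (2 * k + 1) * (1 / (fact (k + 1) * fact k)))"

text \<open>
  Speed ratios \<open>\<theta> / \<rho>\<close> admissible in the pure billiard model (direction change rate
  \<open>\<tau> = 0\<close>), for node speed \<open>v\<close> and node density \<open>\<nu>\<close>.
\<close>

definition speed_ratios :: "real \<Rightarrow> real \<Rightarrow> real set" where
  "speed_ratios v \<nu> = {\<theta> / \<rho> | \<rho> \<theta>.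
     \<rho> > 0 \<and> \<theta> > 0 \<and> 1 - \<nu> * pi * (2 / \<rho>) * bessel_I1 \<rho> > 0 \<and>
     \<theta> = sqrt (\<rho>\<^sup>2 * v\<^sup>2 +
           (4 * pi * v * \<nu> * bessel_I0 \<rho> / (1 - \<nu> * pi * (2 / \<rho>) * bessel_I1 \<rho>))\<^sup>2)}"

text \<open>
  \<open>LEAST\<close> rather than \<open>Inf\<close>: the bound is an attained minimum, which exists
  for \<open>v > 0\<close> and \<open>0 < \<nu> < 1 / \<pi>\<close>. The value is meant only for such arguments.
\<close>

definition speed_bound :: "real \<Rightarrow> real \<Rightarrow> real" where
  "speed_bound v \<nu> = (LEAST s. s \<in> speed_ratios v \<nu>)"

end

theory Submission
  imports Defs
begin

text \<open>
  After division by \<open>\<rho>\<close>, every admissible ratio is \<open>v * sqrt (1 + (4 \<pi> \<nu> I0 \<rho> / D \<rho>)\<^sup>2)\<close> with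
  \<open>D \<rho> = \<rho> - 2 \<pi> \<nu> I1 \<rho> > 0\<close>, so it is at least \<open>v\<close>, and at the fixed value \<open>\<rho> = 1\<close> it is
  \<open>v * (1 + O(\<nu>\<^sup>2))\<close>. Minimising the ratio means maximising \<open>D / I0\<close>, which is continuous; since
  \<open>I1\<close> grows at least cubically, \<open>D > 0\<close> confines \<open>\<rho>\<close> to a bounded interval, so the minimum is
  attained.
\<close>

section \<open>Bessel series: convergence, continuity and lower bounds\<close>

lemma summable_bessel_I0:
  fixes y :: real
  shows "summable (\<lambda>k. (1 / (fact k)\<^sup>2) * y ^ k)"
proof (rule summable_comparison_test')
  show "summable (\<lambda>k. inverse (fact k) * \<bar>y\<bar> ^ k)"
    by (rule summable_exp)
  fix k :: nat
  have "1 / (fact k)\<^sup>2 \<le> inverse (fact k :: real)"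
    using fact_ge_1[of k, where 'a = real] by (simp add: field_simps power2_eq_square)
  then have "(1 / (fact k)\<^sup>2) * \<bar>y\<bar> ^ k \<le> inverse (fact k) * \<bar>y\<bar> ^ k"
    by (rule mult_right_mono) simp
  then show "norm ((1 / (fact k)\<^sup>2) * y ^ k) \<le> inverse (fact k) * \<bar>y\<bar> ^ k"
    by (simp add: abs_mult power_abs)
qed

lemma summable_bessel_I1:
  fixes y :: real
  shows "summable (\<lambda>k. (1 / (fact (k + 1) * fact k)) * y ^ k)"
proof (rule summable_comparison_test')
  show "summable (\<lambda>k. inverse (fact k) * \<bar>y\<bar> ^ k)"
    by (rule summable_exp)
  fix k :: nat
  have "1 / (fact (k + 1) * fact k) \<le> inverse (fact k :: real)"
    using fact_ge_1[of "k + 1", where 'a = real]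
    by (simp add: divide_simps del: fact_Suc)
  then have "(1 / (fact (k + 1) * fact k)) * \<bar>y\<bar> ^ k \<le> inverse (fact k) * \<bar>y\<bar> ^ k"
    by (rule mult_right_mono) simp
  then show "norm ((1 / (fact (k + 1) * fact k)) * y ^ k) \<le> inverse (fact k) * \<bar>y\<bar> ^ k"
    by (simp add: abs_mult power_abs del: fact_Suc)
qed

text \<open>In the variable \<open>(x / 2)\<^sup>2\<close> the series is an ordinary power series,
  so the general summability and continuity results apply; for \<open>bessel_I1\<close> an odd
  factor \<open>x / 2\<close> is split off first.\<close>

lemma bessel_I0_powser: "bessel_I0 x = (\<Sum>k. (1 / (fact k)\<^sup>2) * ((x / 2)\<^sup>2) ^ k)"
  unfolding bessel_I0_def
  by (rule suminf_cong) (subst power_mult, rule mult.commute)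

lemma bessel_I1_powser:
  "bessel_I1 x = x / 2 * (\<Sum>k. (1 / (fact (k + 1) * fact k)) * ((x / 2)\<^sup>2) ^ k)"
proof -
  have "bessel_I1 x = (\<Sum>k. x / 2 * ((1 / (fact (k + 1) * fact k)) * ((x / 2)\<^sup>2) ^ k))"
    unfolding bessel_I1_def
    by (rule suminf_cong) (subst power_add, subst power_mult, simp)
  then show ?thesis
    by (simp only: suminf_mult[OF summable_bessel_I1])
qed

lemma continuous_on_bessel_I0: "continuous_on S bessel_I0"
proof -
  have "isCont (\<lambda>y :: real. \<Sum>k. (1 / (fact k)\<^sup>2) * y ^ k) y" for y
    by (rule isCont_powser_converges_everywhere[OF summable_bessel_I0])
  then have "continuous_on UNIV (\<lambda>y :: real. \<Sum>k. (1 / (fact k)\<^sup>2) * y ^ k)"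
    by (simp add: continuous_at_imp_continuous_on)
  then show ?thesis
    unfolding bessel_I0_powser[abs_def]
    by (rule continuous_on_compose2) (auto intro!: continuous_intros)
qed

lemma continuous_on_bessel_I1: "continuous_on S bessel_I1"
proof -
  have "isCont (\<lambda>y :: real. \<Sum>k. (1 / (fact (k + 1) * fact k)) * y ^ k) y" for y
    by (rule isCont_powser_converges_everywhere[OF summable_bessel_I1])
  then have "continuous_on UNIV (\<lambda>y :: real. \<Sum>k. (1 / (fact (k + 1) * fact k)) * y ^ k)"
    by (simp add: continuous_at_imp_continuous_on)
  then have "continuous_on S (\<lambda>x :: real. \<Sum>k. (1 / (fact (k + 1) * fact k)) * ((x / 2)\<^sup>2) ^ k)"
    by (rule continuous_on_compose2) (auto intro!: continuous_intros)
  then show ?thesis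
    unfolding bessel_I1_powser[abs_def] by (intro continuous_intros) auto
qed

lemma bessel_I0_ge_1: "1 \<le> bessel_I0 x"
proof -
  have "(\<Sum>k<1. (1 / (fact k)\<^sup>2) * ((x / 2)\<^sup>2) ^ k) \<le> bessel_I0 x"
    unfolding bessel_I0_powser by (rule sum_le_suminf[OF summable_bessel_I0]) auto
  then show ?thesis by simp
qed

lemma bessel_I1_0 [simp]: "bessel_I1 0 = 0"
  by (simp add: bessel_I1_powser)

text \<open>These are the first two terms of a series with nonnegative terms. The cubic one matters:
  it makes \<open>2 * pi * \<nu> * bessel_I1 \<rho>\<close> outgrow \<open>\<rho>\<close> for every
  \<open>\<nu> > 0\<close>, however small.\<close>

lemma bessel_I1_ge_cubic:
  assumes "0 \<le> x"
  shows "x / 2 + x ^ 3 / 16 \<le> bessel_I1 x"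
proof -
  have "(\<Sum>k<2. (1 / (fact (k + 1) * fact k)) * ((x / 2)\<^sup>2) ^ k)
      \<le> (\<Sum>k. (1 / (fact (k + 1) * fact k)) * ((x / 2)\<^sup>2) ^ k)"
    by (rule sum_le_suminf[OF summable_bessel_I1]) auto
  then have "x / 2 * (\<Sum>k<2. (1 / (fact (k + 1) * fact k)) * ((x / 2)\<^sup>2) ^ k) \<le> bessel_I1 x"
    unfolding bessel_I1_powser using assms by (intro mult_left_mono) auto
  moreover have "x / 2 * (\<Sum>k<2. (1 / (fact (k + 1) * fact k)) * ((x / 2)\<^sup>2) ^ k)
      = x / 2 + x ^ 3 / 16"
    by (simp add: numeral_2_eq_2 field_simps power3_eq_cube)
  ultimately show ?thesis by simp
qed

section \<open>Admissible ratios and the existence of their minimum\<close>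

lemma speed_ratios_alt:
  assumes "0 < v"
  shows "speed_ratios v \<nu> =
    (\<lambda>\<rho>. v * sqrt (1 + (4 * pi * \<nu> * (bessel_I0 \<rho> / (\<rho> - 2 * pi * \<nu> * bessel_I1 \<rho>)))\<^sup>2)) `
      {\<rho>. 0 < \<rho> \<and> 0 < \<rho> - 2 * pi * \<nu> * bessel_I1 \<rho>}"
proof -
  define D where "D \<rho> = \<rho> - 2 * pi * \<nu> * bessel_I1 \<rho>" for \<rho>
  define \<theta> where "\<theta> \<rho> = sqrt (\<rho>\<^sup>2 * v\<^sup>2 +
      (4 * pi * v * \<nu> * bessel_I0 \<rho> / (1 - \<nu> * pi * (2 / \<rho>) * bessel_I1 \<rho>))\<^sup>2)" for \<rho>
  \<comment> \<open>With this form of the denominator, \<open>\<rho>\<^sup>2 * v\<^sup>2\<close>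
    factors out of the radicand, and the division by \<open>\<rho>\<close> cancels its root up to
    \<open>v\<close>.\<close>
  have den: "1 - \<nu> * pi * (2 / \<rho>) * bessel_I1 \<rho> = D \<rho> / \<rho>" if "0 < \<rho>" for \<rho>
    using that by (simp add: D_def field_simps)
  have pos: "0 < \<theta> \<rho>" if "0 < \<rho>" for \<rho>
    using that assms unfolding \<theta>_def by (simp add: add_pos_nonneg)
  have ratio: "\<theta> \<rho> / \<rho> = v * sqrt (1 + (4 * pi * \<nu> * (bessel_I0 \<rho> / D \<rho>))\<^sup>2)" if "0 < \<rho>" for \<rho>
  proof -
    have "\<theta> \<rho> = sqrt ((\<rho> * v)\<^sup>2 * (1 + (4 * pi * \<nu> * (bessel_I0 \<rho> / D \<rho>))\<^sup>2))"
      unfolding \<theta>_def den[OF that]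
      by (rule arg_cong[where f = sqrt]) (simp add: power_divide power_mult_distrib algebra_simps)
    also have "\<dots> = \<rho> * v * sqrt (1 + (4 * pi * \<nu> * (bessel_I0 \<rho> / D \<rho>))\<^sup>2)"
      using that assms by (simp add: real_sqrt_mult)
    finally show ?thesis using that by simp
  qed
  have "speed_ratios v \<nu> = (\<lambda>\<rho>. \<theta> \<rho> / \<rho>) ` {\<rho>. 0 < \<rho> \<and> 0 < D \<rho>}"
  proof (intro equalityI subsetI)
    fix s
    assume "s \<in> speed_ratios v \<nu>"
    then obtain \<rho> where "0 < \<rho>" "0 < 1 - \<nu> * pi * (2 / \<rho>) * bessel_I1 \<rho>" "s = \<theta> \<rho> / \<rho>"
      unfolding speed_ratios_def \<theta>_def by blast
    then have "0 < D \<rho> / \<rho>" by (simp only: den)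
    then have "0 < D \<rho>" using \<open>0 < \<rho>\<close> by (simp add: zero_less_divide_iff)
    with \<open>0 < \<rho>\<close> \<open>s = \<theta> \<rho> / \<rho>\<close> show "s \<in> (\<lambda>\<rho>. \<theta> \<rho> / \<rho>) ` {\<rho>. 0 < \<rho> \<and> 0 < D \<rho>}"
      by blast
  next
    fix s
    assume "s \<in> (\<lambda>\<rho>. \<theta> \<rho> / \<rho>) ` {\<rho>. 0 < \<rho> \<and> 0 < D \<rho>}"
    then obtain \<rho> where \<rho>: "0 < \<rho>" "0 < D \<rho>" "s = \<theta> \<rho> / \<rho>" by blast
    then have "0 < 1 - \<nu> * pi * (2 / \<rho>) * bessel_I1 \<rho>"
      unfolding den[OF \<open>0 < \<rho>\<close>] by simp
    with \<rho> pos[of \<rho>] show "s \<in> speed_ratios v \<nu>"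
      unfolding speed_ratios_def \<theta>_def by blast
  qed
  also have "\<dots> = (\<lambda>\<rho>. v * sqrt (1 + (4 * pi * \<nu> * (bessel_I0 \<rho> / D \<rho>))\<^sup>2)) ` {\<rho>. 0 < \<rho> \<and> 0 < D \<rho>}"
    using ratio by (intro image_cong) auto
  finally show ?thesis unfolding D_def .
qed

lemma speed_ratios_has_least:
  assumes "0 < v" "0 < \<nu>" and ne: "speed_ratios v \<nu> \<noteq> {}"
  shows "\<exists>s\<in>speed_ratios v \<nu>. \<forall>t\<in>speed_ratios v \<nu>. s \<le> t"
proof -
  define D where "D \<rho> = \<rho> - 2 * pi * \<nu> * bessel_I1 \<rho>" for \<rho>
  \<comment> \<open>Beyond \<open>R\<close> both \<open>\<rho> \<ge> 1\<close> and
    \<open>pi * \<nu> * \<rho> \<ge> 8\<close> hold. Together they give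
    \<open>pi * \<nu> * \<rho>\<^sup>2 \<ge> 8\<close>, whereas the cubic bound and
    \<open>D \<rho> > 0\<close> force the opposite strict inequality.\<close>
  define R where "R = 1 + 8 / (pi * \<nu>)"
  have "0 < pi * \<nu>" using assms by simp
  then have "1 \<le> R" by (simp add: R_def)
  have bounded: "\<rho> \<le> R" if "0 < \<rho>" "0 < D \<rho>" for \<rho>
  proof (rule ccontr)
    assume "\<not> \<rho> \<le> R"
    then have \<rho>: "1 \<le> \<rho>" "8 / (pi * \<nu>) \<le> \<rho>"
      using \<open>1 \<le> R\<close> unfolding R_def by linarith+
    have "pi * \<nu> * (\<rho> ^ 3 / 8) \<le> pi * \<nu> * (2 * bessel_I1 \<rho>)"
      using bessel_I1_ge_cubic[of \<rho>] that \<open>0 < pi * \<nu>\<close> by (intro mult_left_mono) auto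
    also have "\<dots> < \<rho>"
      using that(2) by (simp add: D_def algebra_simps)
    finally have "pi * \<nu> * (\<rho> ^ 3 / 8) < \<rho>" .
    moreover have "8 * \<rho> \<le> (pi * \<nu> * \<rho>) * (\<rho> * \<rho>)"
      using \<rho> \<open>0 < pi * \<nu>\<close> mult_mono[of 8 "pi * \<nu> * \<rho>" \<rho> "\<rho> * \<rho>"] by (simp add: field_simps)
    ultimately show False by (simp add: power3_eq_cube algebra_simps)
  qed
  have I0: "0 < bessel_I0 \<rho>" for \<rho>
    using bessel_I0_ge_1[of \<rho>] by linarith
  \<comment> \<open>The reciprocal of the varying factor of the ratio is used:
    \<open>bessel_I0\<close> never vanishes, so this quotient is continuous on the whole compact
    interval, also at 0 and at other zeros of \<open>D\<close>.\<close>
  have "continuous_on {0..R} (\<lambda>\<rho>. D \<rho> / bessel_I0 \<rho>)"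
    unfolding D_def using I0
    by (intro continuous_intros continuous_on_bessel_I0 continuous_on_bessel_I1)
      (simp add: less_imp_neq[THEN not_sym])
  then obtain m where m: "m \<in> {0..R}"
    and max: "\<And>\<rho>. \<rho> \<in> {0..R} \<Longrightarrow> D \<rho> / bessel_I0 \<rho> \<le> D m / bessel_I0 m"
    using continuous_attains_sup[of "{0..R}" "\<lambda>\<rho>. D \<rho> / bessel_I0 \<rho>"] \<open>1 \<le> R\<close> by auto
  \<comment> \<open>Any admissible point lies in the interval and makes the maximum positive. Hence
    \<open>D m > 0\<close>, and \<open>m\<close> is not the endpoint 0, where \<open>D\<close>
    vanishes: the maximiser is itself admissible.\<close>
  obtain r where r: "0 < r" "0 < D r"
    using ne unfolding speed_ratios_alt[OF \<open>0 < v\<close>] D_def by auto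
  have "0 < D r / bessel_I0 r" using r I0 by simp
  also have "\<dots> \<le> D m / bessel_I0 m" using r bounded by (intro max) auto
  finally have Dm: "0 < D m" using I0[of m] by (simp add: zero_less_divide_iff)
  then have "m \<noteq> 0" by (auto simp: D_def)
  with m have "0 < m" by simp
  have "v * sqrt (1 + (4 * pi * \<nu> * (bessel_I0 m / D m))\<^sup>2)
      \<le> v * sqrt (1 + (4 * pi * \<nu> * (bessel_I0 \<rho> / D \<rho>))\<^sup>2)" if \<rho>: "0 < \<rho>" "0 < D \<rho>" for \<rho>
  proof -
    have "D \<rho> / bessel_I0 \<rho> \<le> D m / bessel_I0 m"
      using \<rho> bounded by (intro max) auto
    then have "bessel_I0 m / D m \<le> bessel_I0 \<rho> / D \<rho>"
      using \<rho> Dm I0[of m] I0[of \<rho>] by (simp add: field_simps)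
    then have "(4 * pi * \<nu> * (bessel_I0 m / D m))\<^sup>2 \<le> (4 * pi * \<nu> * (bessel_I0 \<rho> / D \<rho>))\<^sup>2"
      using assms Dm I0[of m] by (intro power_mono mult_left_mono mult_nonneg_nonneg) auto
    then show ?thesis using \<open>0 < v\<close> by simp
  qed
  then show ?thesis
    unfolding speed_ratios_alt[OF \<open>0 < v\<close>] D_def[symmetric] using \<open>0 < m\<close> Dm by blast
qed

text \<open>\<open>LEAST\<close> on the reals is informative only if a least element exists; here
  \<open>t\<close> witnesses nonemptiness, from which attainment follows.\<close>

lemma speed_bound_least:
  assumes "0 < v" "0 < \<nu>" "t \<in> speed_ratios v \<nu>"
  shows "speed_bound v \<nu> \<in> speed_ratios v \<nu>" "speed_bound v \<nu> \<le> t"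
proof -
  obtain s where s: "s \<in> speed_ratios v \<nu>" "\<forall>t\<in>speed_ratios v \<nu>. s \<le> t"
    using speed_ratios_has_least assms by blast
  then have "speed_bound v \<nu> = s"
    unfolding speed_bound_def by (intro Least_equality) auto
  with s assms show "speed_bound v \<nu> \<in> speed_ratios v \<nu>" "speed_bound v \<nu> \<le> t"
    by auto
qed

section \<open>Two-sided bound for small density\<close>

lemma speed_ratios_ge:
  assumes "0 < v" "s \<in> speed_ratios v \<nu>"
  shows "v \<le> s"
  using assms by (auto simp: speed_ratios_alt)

text \<open>A number that is at least 1 is at most its square. This crude bound suffices, since only
  the order in \<open>x\<^sup>2\<close> matters.\<close>

lemma sqrt_one_plus_square_le: "sqrt (1 + x\<^sup>2) \<le> 1 + x\<^sup>2"
  for x :: real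
  by (rule real_le_lsqrt) (auto intro: self_le_power)

text \<open>The upper bound tests the minimum at \<open>\<rho> = 1\<close>. The smallness hypothesis
  on \<open>\<nu>\<close> keeps \<open>D\<close> at least 1/2 there, which doubles
  \<open>4 * pi * bessel_I0 1\<close> into the constant 8 \<pi> I0(1).\<close>

lemma speed_bound_upper:
  assumes "0 < v" "0 < \<nu>" "4 * pi * \<nu> * bessel_I1 1 \<le> 1"
  shows "v \<le> speed_bound v \<nu>" "speed_bound v \<nu> \<le> v * (1 + (8 * pi * bessel_I0 1)\<^sup>2 * \<nu>\<^sup>2)"
proof -
  define D where "D = 1 - 2 * pi * \<nu> * bessel_I1 1"
  have D: "1 / 2 \<le> D" using assms(3) by (simp add: D_def)
  define x where "x = 4 * pi * \<nu> * (bessel_I0 1 / D)"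
  have mem: "v * sqrt (1 + x\<^sup>2) \<in> speed_ratios v \<nu>"
    unfolding speed_ratios_alt[OF \<open>0 < v\<close>] x_def D_def
    by (rule image_eqI[of _ _ 1]) (use D in \<open>auto simp: D_def\<close>)
  show "v \<le> speed_bound v \<nu>"
    using speed_ratios_ge speed_bound_least(1)[OF _ _ mem] assms by blast
  have "1 \<le> bessel_I0 1" by (rule bessel_I0_ge_1)
  then have "bessel_I0 1 / D \<le> 2 * bessel_I0 1"
    using D mult_left_mono[of "1/2" D "2 * bessel_I0 1"] by (simp add: field_simps)
  then have "x \<le> 4 * pi * \<nu> * (2 * bessel_I0 1)"
    unfolding x_def using assms by (intro mult_left_mono) auto
  moreover have "0 \<le> x" unfolding x_def using assms D \<open>1 \<le> bessel_I0 1\<close> by auto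
  ultimately have "x\<^sup>2 \<le> (4 * pi * \<nu> * (2 * bessel_I0 1))\<^sup>2" by (rule power_mono)
  also have "\<dots> = (8 * pi * bessel_I0 1)\<^sup>2 * \<nu>\<^sup>2" by (simp add: power_mult_distrib)
  finally have "sqrt (1 + x\<^sup>2) \<le> 1 + (8 * pi * bessel_I0 1)\<^sup>2 * \<nu>\<^sup>2"
    using sqrt_one_plus_square_le[of x] by linarith
  then have "v * sqrt (1 + x\<^sup>2) \<le> v * (1 + (8 * pi * bessel_I0 1)\<^sup>2 * \<nu>\<^sup>2)"
    using \<open>0 < v\<close> by (intro mult_left_mono) auto
  then show "speed_bound v \<nu> \<le> v * (1 + (8 * pi * bessel_I0 1)\<^sup>2 * \<nu>\<^sup>2)"
    using speed_bound_least(2)[OF _ _ mem] assms by linarith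
qed

theorem corollary2:
  fixes v :: real
  assumes "v > 0"
  shows "\<exists>g \<in> O[at_right 0](\<lambda>\<nu>. \<nu>\<^sup>2).
           \<forall>\<nu>\<in>{0<..<1 / pi}. speed_bound v \<nu> = (1 + g \<nu>) * v"
proof (intro bexI ballI)
  \<comment> \<open>The relative excess over \<open>v\<close> satisfies the identity for every
    \<open>\<nu>\<close>; only its order of magnitude needs small \<open>\<nu>\<close>.\<close>
  let ?g = "\<lambda>\<nu>. speed_bound v \<nu> / v - 1"
  show "speed_bound v \<nu> = (1 + ?g \<nu>) * v" for \<nu>
    using assms by simp
  have I1: "0 < bessel_I1 1" using bessel_I1_ge_cubic[of 1] by simp
  \<comment> \<open>This interval is where the smallness hypothesis of
    \<open>speed_bound_upper\<close> holds. The lower bound there makes \<open>?g \<nu>\<close>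
    nonnegative, so the upper bound alone controls its norm.\<close>
  have "\<forall>\<^sub>F \<nu> in at_right 0. \<nu> \<in> {0<..<1 / (4 * pi * bessel_I1 1)}"
    using I1 by (intro eventually_at_right_real) simp
  then have "\<forall>\<^sub>F \<nu> in at_right 0. norm (?g \<nu>) \<le> (8 * pi * bessel_I0 1)\<^sup>2 * norm (\<nu>\<^sup>2)"
  proof eventually_elim
    case (elim \<nu>)
    then have "0 < \<nu>" "4 * pi * \<nu> * bessel_I1 1 \<le> 1"
      using I1 by (auto simp: field_simps)
    from speed_bound_upper[OF assms this] show ?case
      using assms by (simp add: field_simps)
  qed
  then show "?g \<in> O[at_right 0](\<lambda>\<nu>. \<nu>\<^sup>2)"
    by (rule bigoI)
qed

end
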